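(* Let $n\ge 2$, $a_1,\ldots,a_{n-1}$ nonnegative integers with at least one $a_i=0$, and $\lambda=\sum a_i\omega_i$. A point $v\in U$ is a vertex of $P_\lambda$ if and only if $v=\sum_{i=1}^{n-1}a_i\chi_{A_i}$ for some nice tuple $(A_1,\ldots,A_{n-1})$.
   Context: Let $U=\mathbb R^{\binom n2}$ with coordinates $x_{i,j}$, $1\le i<j\le n$. A Dyck path is a sequence $d=((i_1,j_1),\ldots,(i_N,j_N))$ of pairs with $1\le i_k<j_k\le n$, $j_1-i_1=j_N-i_N=1$, and each $(i_{k+1},j_{k+1})$ equal to $(i_k+1,j_k)$ or $(i_k,j_k+1)$. For $\mu=\sum b_i\omega_i$ with $b_i\ge 0$ integers put $S(x,d)=\sum_{(i,j)\in d}x_{i,j}$, $M(\mu,d)=b_{i_1}+b_{i_1+1}+\ldots+b_{i_N}$ and $P_\mu=\{x\in U: x\ge 0,\ S(x,d)\le M(\mu,d)\ \forall d\}$. Order pairs by $(i_1,j_1)\preceq(i_2,j_2)$ iff $i_1\le i_2$ and $j_1\le j_2$. Let $Q_i=\{(k,l):1\le k\le i,\ i+1\le l\le n\}$. For a set $A$ of pairs, $\chi_A\in U$ is its indicator function. A tuple $(A_1,\ldots,A_{n-1})$ with each $A_i\subset Q_i$ a $\preceq$-antichain is called nice if for every $\lambda'=\sum a'_i\omega_i$ with all $a'_i$ positive integers the point $\sum a'_i\chi_{A_i}$ is a vertex of $P_{\lambda'}$. *)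

theory Defs
  imports "HOL-Analysis.Analysis" "HOL-Analysis.Finite_Function_Topology"
begin

text \<open>
  The space \<open>U\<close> of dimension \<open>n choose 2\<close> is realised as the subspace of the finitely supported
  functions on \<open>nat \<times> nat\<close> whose support lies in the set of pairs \<open>(i, j)\<close> with
  \<open>1 \<le> i < j \<le> n\<close>; this makes it available inside one real vector space for all \<open>n\<close>.
  A weight \<open>\<Sum>i. b\<^sub>i \<omega>\<^sub>i\<close> is represented by its coefficient function \<open>b\<close>, of which only the values
  on \<open>{1..n - 1}\<close> are relevant. Likewise for tuples of sets.
\<close>

type_synonym point = "nat \<times> nat \<Rightarrow>\<^sub>0 real"

definition pairs :: "nat \<Rightarrow> (nat \<times> nat) set" where
  "pairs n = {(i, j). 1 \<le> i \<and> i < j \<and> j \<le> n}"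

definition U :: "nat \<Rightarrow> point set" where
  "U n = {x. Poly_Mapping.keys x \<subseteq> pairs n}"

definition dyck_path :: "nat \<Rightarrow> (nat \<times> nat) list \<Rightarrow> bool" where
  "dyck_path n d \<longleftrightarrow>
     d \<noteq> [] \<and> set d \<subseteq> pairs n \<and>
     snd (hd d) = fst (hd d) + 1 \<and> snd (last d) = fst (last d) + 1 \<and>
     (\<forall>k. k + 1 < length d \<longrightarrow>
        d ! (k + 1) = (fst (d ! k) + 1, snd (d ! k)) \<or>
        d ! (k + 1) = (fst (d ! k), snd (d ! k) + 1))"

definition S :: "point \<Rightarrow> (nat \<times> nat) list \<Rightarrow> real" where
  "S x d = (\<Sum>p\<leftarrow>d. Poly_Mapping.lookup x p)"

definition M :: "(nat \<Rightarrow> nat) \<Rightarrow> (nat \<times> nat) list \<Rightarrow> nat" where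
  "M b d = (\<Sum>i = fst (hd d)..fst (last d). b i)"

definition P :: "nat \<Rightarrow> (nat \<Rightarrow> nat) \<Rightarrow> point set" where
  "P n b = {x \<in> U n. (\<forall>p \<in> pairs n. 0 \<le> Poly_Mapping.lookup x p) \<and>
                     (\<forall>d. dyck_path n d \<longrightarrow> S x d \<le> real (M b d))}"

definition pair_le :: "nat \<times> nat \<Rightarrow> nat \<times> nat \<Rightarrow> bool" (infix \<open>\<preceq>\<close> 50) where
  "p \<preceq> q \<longleftrightarrow> fst p \<le> fst q \<and> snd p \<le> snd q"

definition antichain :: "(nat \<times> nat) set \<Rightarrow> bool" where
  "antichain A \<longleftrightarrow> (\<forall>p \<in> A. \<forall>q \<in> A. p \<preceq> q \<longrightarrow> p = q)"

definition Q :: "nat \<Rightarrow> nat \<Rightarrow> (nat \<times> nat) set" where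
  "Q n i = {(k, l). 1 \<le> k \<and> k \<le> i \<and> i + 1 \<le> l \<and> l \<le> n}"

text \<open>Meaningful for finite sets only; all sets it is applied to are subsets of some \<open>Q n i\<close>.\<close>

definition chi :: "(nat \<times> nat) set \<Rightarrow> point" where
  "chi A = Abs_poly_mapping (indicator A)"

lemma lookup_chi: "finite A \<Longrightarrow> Poly_Mapping.lookup (chi A) p = indicator A p"
  unfolding chi_def
  by (subst Abs_poly_mapping_inverse) (auto simp: indicator_def)

lemma finite_Q: "finite (Q n i)"
  by (rule finite_subset[of _ "{..i} \<times> {..n}"]) (auto simp: Q_def)

definition nice :: "nat \<Rightarrow> (nat \<Rightarrow> (nat \<times> nat) set) \<Rightarrow> bool" where
  "nice n A \<longleftrightarrow>
     (\<forall>i \<in> {1..n - 1}. A i \<subseteq> Q n i \<and> antichain (A i)) \<and>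
     (\<forall>a'. (\<forall>i \<in> {1..n - 1}. 0 < a' i) \<longrightarrow>
        (\<Sum>i = 1..n - 1. real (a' i) *\<^sub>R chi (A i)) extreme_point_of P n a')"

end

theory Submission
  imports Defs
begin

text \<open>
  Write \<open>e\<^sub>i\<close> for the \<open>i\<close>-th unit weight. A point \<open>x\<close> of \<open>P n b\<close> is encoded by its height function:
  the height of \<open>(k, k)\<close> is \<open>b\<^sub>1 + \<dots> + b\<^sub>k\<^sub>-\<^sub>1\<close>, and \<open>x\<close> at \<open>(i, j)\<close> is the height there minus the larger of the
  heights at \<open>(i - 1, j)\<close> and \<open>(i, j - 1)\<close>. The Dyck path inequalities say precisely that the heights at
  \<open>(k - 1, k)\<close> do not exceed that at \<open>(k, k)\<close>. Truncating heights to an interval commutes with taking maxima, so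
  cutting out a unit interval above the height of \<open>(i, i)\<close> splits every point of \<open>P n (a + e\<^sub>i)\<close> as a
  point of \<open>P n a\<close> plus one of \<open>P n e\<^sub>i\<close>, and the latter is an average of indicators of
  antichains in \<open>Q n i\<close>, namely the minimal elements of the superlevel sets of the heights.

  If \<open>v\<close> is a vertex of a convex set \<open>K\<close> and \<open>V\<close> is finite, then \<open>v + l\<close> is a vertex
  of \<open>K + conv V\<close> for some \<open>l \<in> V\<close>. Hence a vertex \<open>v\<close> of \<open>P n a\<close> extends to a vertex
  \<open>v + \<Sum>\<^sub>i \<chi>(A\<^sub>i)\<close> of \<open>P n (a + 1)\<close>; uniqueness of Minkowski decompositions of vertices
  forces \<open>v = \<Sum>\<^sub>i a\<^sub>i \<chi>(A\<^sub>i)\<close>, and whether such a sum is a vertex is inherited when the support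
  of the weight stays the same or shrinks.
\<close>

section \<open>Extreme points of convex sets and of Minkowski sums\<close>

lemma extreme_point_of_iff:
  "v extreme_point_of X \<longleftrightarrow> v \<in> X \<and>
     (\<forall>p\<in>X. \<forall>q\<in>X. \<forall>s. 0 < s \<longrightarrow> s < 1 \<longrightarrow> v = (1 - s) *\<^sub>R p + s *\<^sub>R q \<longrightarrow> p = v \<and> q = v)"
proof
  assume L: "v extreme_point_of X"
  have "p = v \<and> q = v" if "p \<in> X" "q \<in> X" "0 < s" "s < 1" and v: "v = (1 - s) *\<^sub>R p + s *\<^sub>R q" for p q s
  proof -
    have "v \<notin> open_segment p q" using L that(1,2) by (auto simp: extreme_point_of_def)
    then have "p = q" using that by (auto simp: in_segment)
    then show ?thesis using v by (simp add: scaleR_left_diff_distrib)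
  qed
  with L show "v \<in> X \<and> (\<forall>p\<in>X. \<forall>q\<in>X. \<forall>s. 0 < s \<longrightarrow> s < 1 \<longrightarrow> v = (1 - s) *\<^sub>R p + s *\<^sub>R q \<longrightarrow> p = v \<and> q = v)"
    by (auto simp: extreme_point_of_def)
next
  assume "v \<in> X \<and> (\<forall>p\<in>X. \<forall>q\<in>X. \<forall>s. 0 < s \<longrightarrow> s < 1 \<longrightarrow> v = (1 - s) *\<^sub>R p + s *\<^sub>R q \<longrightarrow> p = v \<and> q = v)"
  then show "v extreme_point_of X" unfolding extreme_point_of_def in_segment by metis
qed

lemma extreme_point_of_eq:
  assumes "v extreme_point_of X" "p \<in> X" "q \<in> X" "0 < s" "s < 1" "v = (1 - s) *\<^sub>R p + s *\<^sub>R q"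
  shows "p = v" "q = v"
  using assms unfolding extreme_point_of_iff by blast+

text \<open>An extreme point is never the midpoint of two other points. Exchanging a summand between
  two Minkowski decompositions moves the point by opposite amounts, so this yields their
  uniqueness.\<close>

lemma extreme_point_of_symmetric:
  assumes "v extreme_point_of X" "v + w \<in> X" "v - w \<in> X"
  shows "w = 0"
proof -
  have "(1 - 1 / 2) *\<^sub>R (v + w) + (1 / 2) *\<^sub>R (v - w) = (1 / 2 :: real) *\<^sub>R ((v + w) + (v - w))"
    unfolding scaleR_add_right by simp
  also have "(v + w) + (v - w) = 2 *\<^sub>R v" by (simp add: scaleR_2)
  finally have "v = (1 - 1 / 2) *\<^sub>R (v + w) + (1 / 2) *\<^sub>R (v - w)" by simp
  from extreme_point_of_eq(1)[OF assms(1,2,3) _ _ this] show ?thesis by simp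
qed

text \<open>
  A generator lying in the hull of the others plus the cone can be dropped; one that does not is
  itself extreme.
\<close>

lemma extreme_point_hull_plus_cone:
  fixes V C :: "'a::real_vector set"
  assumes "finite V" "V \<noteq> {}" and zero: "0 \<in> C"
    and add: "\<And>c d. c \<in> C \<Longrightarrow> d \<in> C \<Longrightarrow> c + d \<in> C"
    and scale: "\<And>c t. c \<in> C \<Longrightarrow> 0 \<le> t \<Longrightarrow> t *\<^sub>R c \<in> C"
    and salient: "\<And>c. c \<in> C \<Longrightarrow> - c \<in> C \<Longrightarrow> c = 0"
  shows "\<exists>l\<in>V. l extreme_point_of {u + c |u c. u \<in> convex hull V \<and> c \<in> C}"
proof -
  have salient2: "c = 0 \<and> d = 0"
    if "c \<in> C" "d \<in> C" "0 < s" "s < 1" "(1 - s) *\<^sub>R c + s *\<^sub>R d = 0" for c d and s :: real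
  proof -
    have 1: "s *\<^sub>R d = - ((1 - s) *\<^sub>R c)" using that(5) by (simp add: add_eq_0_iff)
    have "(1 - s) *\<^sub>R c \<in> C" "s *\<^sub>R d \<in> C" using that by (auto intro: scale)
    with 1 have "(1 - s) *\<^sub>R c = 0" by (metis salient)
    with 1 that(3,4) show ?thesis by auto
  qed
  from assms(1,2) show ?thesis
  proof (induction V rule: finite_ne_induct)
    case (singleton l)
    let ?H = "{u + c |u c. u \<in> convex hull {l} \<and> c \<in> C}"
    have "p = l \<and> q = l"
      if "p \<in> ?H" "q \<in> ?H" and s: "0 < s" "s < 1"
        and eq: "l = (1 - s) *\<^sub>R p + s *\<^sub>R q" for p q and s :: real
    proof -
      from that(1,2) obtain c d where pq: "p = l + c" "q = l + d" "c \<in> C" "d \<in> C"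
        unfolding convex_hull_singleton by blast
      have "(1 - s) *\<^sub>R c + s *\<^sub>R d = 0" using eq unfolding pq by (simp add: algebra_simps)
      then show ?thesis using salient2 pq s by simp
    qed
    moreover have "l \<in> ?H"
      by (rule CollectI, rule exI[of _ l], rule exI[of _ 0]) (use zero in simp)
    ultimately have "l extreme_point_of ?H"
      unfolding extreme_point_of_iff by blast
    then show ?case by blast
  next
    case (insert l V)
    let ?H = "\<lambda>W. {u + c |u c. u \<in> convex hull W \<and> c \<in> C}"
    have hull: "convex hull (insert l V) = {t *\<^sub>R l + s *\<^sub>R b |t s b. 0 \<le> t \<and> 0 \<le> s \<and> t + s = 1 \<and> b \<in> convex hull V}"
      using convex_hull_insert[OF insert.hyps(2)] by blast
    show ?case
    proof (cases "l \<in> ?H V")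
      case True
      then obtain w d where l: "l = w + d" "w \<in> convex hull V" "d \<in> C" by blast
      have "?H (insert l V) \<subseteq> ?H V"
      proof clarify
        fix u c assume "u \<in> convex hull (insert l V)" and c: "c \<in> C"
        then obtain t s b where u: "u = t *\<^sub>R l + s *\<^sub>R b" "0 \<le> t" "0 \<le> s" "t + s = 1" "b \<in> convex hull V"
          unfolding hull by blast
        have "u + c = (t *\<^sub>R w + s *\<^sub>R b) + (t *\<^sub>R d + c)" by (simp add: u l algebra_simps)
        moreover have "t *\<^sub>R w + s *\<^sub>R b \<in> convex hull V"
          using u l by (intro convexD[OF convex_convex_hull]) auto
        moreover have "t *\<^sub>R d + c \<in> C" using u l c add scale by blast
        ultimately show "\<exists>ua ca. u + c = ua + ca \<and> ua \<in> convex hull V \<and> ca \<in> C" by blast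
      qed
      moreover have "?H V \<subseteq> ?H (insert l V)" using hull_mono[of V "insert l V" convex] by blast
      ultimately have "?H (insert l V) = ?H V" by blast
      then show ?thesis using insert.IH by auto
    next
      case False
      have "p = l \<and> q = l" if pq: "p \<in> ?H (insert l V)" "q \<in> ?H (insert l V)" and s: "0 < s" "s < 1"
          and eq: "l = (1 - s) *\<^sub>R p + s *\<^sub>R q" for p q and s :: real
      proof -
        from pq(1) obtain t \<alpha> u c where p: "p = t *\<^sub>R l + \<alpha> *\<^sub>R u + c" "0 \<le> t" "0 \<le> \<alpha>" "t + \<alpha> = 1"
            "u \<in> convex hull V" "c \<in> C" unfolding hull by blast
        from pq(2) obtain t' \<beta> w d where q: "q = t' *\<^sub>R l + \<beta> *\<^sub>R w + d" "0 \<le> t'" "0 \<le> \<beta>" "t' + \<beta> = 1"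
            "w \<in> convex hull V" "d \<in> C" unfolding hull by blast
        have t: "t = 1 - \<alpha>" "t' = 1 - \<beta>" using p q by auto
        \<comment> \<open>\<gamma> is the total weight that falls on \<open>convex hull V\<close> in
          the combination. Were it positive, dividing \<open>rel\<close> by it would put
          \<open>l\<close> into \<open>?H V\<close>, against the case assumption.\<close>
        define \<gamma> where "\<gamma> = (1 - s) * \<alpha> + s * \<beta>"
        define e where "e = (1 - s) *\<^sub>R c + s *\<^sub>R d"
        have e: "e \<in> C" unfolding e_def using p q s by (intro add scale) auto
        have rel: "\<gamma> *\<^sub>R l = ((1 - s) * \<alpha>) *\<^sub>R u + (s * \<beta>) *\<^sub>R w + e"
          using eq unfolding p(1) q(1) t \<gamma>_def e_def by (simp add: algebra_simps)
        have "\<gamma> = 0"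
        proof (rule ccontr)
          assume "\<gamma> \<noteq> 0"
          moreover have nn: "0 \<le> (1 - s) * \<alpha>" "0 \<le> s * \<beta>" using p q s by auto
          ultimately have g: "\<gamma> > 0" unfolding \<gamma>_def by linarith
          have "l = (1 / \<gamma>) *\<^sub>R (\<gamma> *\<^sub>R l)" using g by simp
          also have "\<dots> = (((1 - s) * \<alpha> / \<gamma>) *\<^sub>R u + (s * \<beta> / \<gamma>) *\<^sub>R w) + (1 / \<gamma>) *\<^sub>R e"
            unfolding rel by (simp add: scaleR_add_right)
          finally have "l = \<dots>" .
          moreover have "((1 - s) * \<alpha> / \<gamma>) *\<^sub>R u + (s * \<beta> / \<gamma>) *\<^sub>R w \<in> convex hull V"
            using p q g nn by (intro convexD[OF convex_convex_hull])
              (auto simp: \<gamma>_def simp flip: add_divide_distrib)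
          moreover have "(1 / \<gamma>) *\<^sub>R e \<in> C" using e g by (intro scale) auto
          ultimately show False using False by blast
        qed
        then have ab: "\<alpha> = 0" "\<beta> = 0"
          using p(3) q(3) s unfolding \<gamma>_def by (auto simp: add_nonneg_eq_0_iff)
        then have "e = 0" using rel \<open>\<gamma> = 0\<close> by simp
        then have "c = 0" "d = 0" using salient2 p q s unfolding e_def by blast+
        then show ?thesis using p q ab by simp
      qed
      moreover have "l \<in> ?H (insert l V)" 
        by (rule CollectI, rule exI[of _ l], rule exI[of _ 0]) (use zero hull_inc[of l "insert l V"] in simp)
      ultimately show ?thesis unfolding extreme_point_of_iff by blast
    qed
  qed
qed

text \<open>The cone \<open>C\<close> generated by \<open>K - v\<close> is salient because
  \<open>v\<close> is extreme, so some \<open>l\<close> is extreme in \<open>convex hull V\<close>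
  plus \<open>C\<close>. That set contains the translate by \<open>- v\<close> of \<open>K\<close>
  plus \<open>convex hull V\<close>, and extremality passes to a subset that contains the
  point.\<close>

lemma extreme_point_plus_hull:
  fixes K V :: "'a::real_vector set"
  assumes K: "convex K" and v: "v extreme_point_of K" and V: "finite V" "V \<noteq> {}"
  shows "\<exists>l\<in>V. (v + l) extreme_point_of {k + u |k u. k \<in> K \<and> u \<in> convex hull V}"
proof -
  define C where "C = {t *\<^sub>R (k - v) |t k. 0 \<le> t \<and> k \<in> K}"
  have vK: "v \<in> K" using v by (simp add: extreme_point_of_def)
  have CI: "t *\<^sub>R (k - v) \<in> C" if "0 \<le> t" "k \<in> K" for t k using that unfolding C_def by blast
  have "\<exists>l\<in>V. l extreme_point_of {u + c |u c. u \<in> convex hull V \<and> c \<in> C}"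
  proof (rule extreme_point_hull_plus_cone[OF V])
    show "0 \<in> C" using CI[of 0 v] vK by simp
    show "c + d \<in> C" if cd: "c \<in> C" "d \<in> C" for c d
    proof -
      from cd obtain t k t' k' where c: "c = t *\<^sub>R (k - v)" "0 \<le> t" "k \<in> K"
        and d: "d = t' *\<^sub>R (k' - v)" "0 \<le> t'" "k' \<in> K" unfolding C_def by blast
      show ?thesis
      proof (cases "t + t' = 0")
        case True
        then show ?thesis using c d CI[of 0 v] vK by (simp add: add_nonneg_eq_0_iff)
      next
        case False
        let ?k = "(t / (t + t')) *\<^sub>R k + (t' / (t + t')) *\<^sub>R k'"
        have "?k \<in> K" using c d False by (intro convexD[OF K]) (auto simp flip: add_divide_distrib)
        moreover have "c + d = (t + t') *\<^sub>R (?k - v)"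
          using False by (simp add: c d scaleR_diff_right scaleR_add_right scaleR_add_left)
        ultimately show ?thesis using CI c d by simp
      qed
    qed
    show "s *\<^sub>R c \<in> C" if c: "c \<in> C" "0 \<le> s" for c s
    proof -
      from c obtain t k where "c = t *\<^sub>R (k - v)" "0 \<le> t" "k \<in> K" unfolding C_def by blast
      then show ?thesis using CI[of "s * t" k] c(2) by simp
    qed
    show "c = 0" if c: "c \<in> C" "- c \<in> C" for c
    proof -
      from c obtain t k t' k' where c: "c = t *\<^sub>R (k - v)" "0 \<le> t" "k \<in> K"
        and d: "- c = t' *\<^sub>R (k' - v)" "0 \<le> t'" "k' \<in> K" unfolding C_def by blast
      show ?thesis
      proof (cases "t = 0 \<or> t' = 0")
        case True
        then show ?thesis using c d by auto
      next
        case False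
        then have pos: "0 < t" "0 < t'" using c d by auto
        \<comment> \<open>Opposite positive multiples of \<open>k - v\<close> and
          \<open>k' - v\<close> make \<open>v\<close> a proper convex combination of
          \<open>k\<close> and \<open>k'\<close>.\<close>
        have sum: "t *\<^sub>R (k - v) + t' *\<^sub>R (k' - v) = 0" using c(1) d(1) by (metis add.right_inverse)
        then have "(t + t') *\<^sub>R v = t *\<^sub>R k + t' *\<^sub>R k'" by (simp add: algebra_simps)
        then have "(1 / (t + t')) *\<^sub>R ((t + t') *\<^sub>R v) = (1 / (t + t')) *\<^sub>R (t *\<^sub>R k + t' *\<^sub>R k')" by simp
        then have "v = (t / (t + t')) *\<^sub>R k + (t' / (t + t')) *\<^sub>R k'" using pos by (simp add: scaleR_add_right)
        moreover have "t / (t + t') = 1 - t' / (t + t')" using pos by (simp add: field_simps)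
        ultimately have "k = v"
          using pos by (intro extreme_point_of_eq(1)[OF v c(3) d(3), of "t' / (t + t')"]) auto
        then show ?thesis using c by simp
      qed
    qed
  qed
  then obtain l where l: "l \<in> V" and ext: "l extreme_point_of {u + c |u c. u \<in> convex hull V \<and> c \<in> C}" by blast
  have "(v + l) extreme_point_of {k + u |k u. k \<in> K \<and> u \<in> convex hull V}"
    unfolding extreme_point_of_iff
  proof (intro conjI ballI allI impI)
    show "v + l \<in> {k + u |k u. k \<in> K \<and> u \<in> convex hull V}" using vK l hull_inc[of l V] by blast
    have shift: "p - v \<in> {u + c |u c. u \<in> convex hull V \<and> c \<in> C}"
      if "p \<in> {k + u |k u. k \<in> K \<and> u \<in> convex hull V}" for p
    proof -
      from that obtain k u where p: "p = k + u" "k \<in> K" "u \<in> convex hull V" by blast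
      then have "p - v = u + 1 *\<^sub>R (k - v)" by simp
      moreover have "1 *\<^sub>R (k - v) \<in> C" using CI[of 1 k] p(2) by simp
      ultimately show ?thesis using p(3) by blast
    qed
    fix p q and s :: real
    assume p: "p \<in> {k + u |k u. k \<in> K \<and> u \<in> convex hull V}" and q: "q \<in> {k + u |k u. k \<in> K \<and> u \<in> convex hull V}"
      and s: "0 < s" "s < 1" and eq: "v + l = (1 - s) *\<^sub>R p + s *\<^sub>R q"
    have "l = (1 - s) *\<^sub>R p + s *\<^sub>R q - v" using eq by (simp add: algebra_simps)
    then have "l = (1 - s) *\<^sub>R (p - v) + s *\<^sub>R (q - v)" by (simp add: algebra_simps)
    from extreme_point_of_eq[OF ext shift[OF p] shift[OF q] s this]
    show "p = v + l" "q = v + l" by (auto simp: algebra_simps)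
  qed
  with l show ?thesis by blast
qed


section \<open>Linear operations on points, and how \<open>P\<close> responds to them\<close>

lemma lookup_scaleR: "Poly_Mapping.lookup (r *\<^sub>R (x :: point)) p = r * Poly_Mapping.lookup x p"
proof -
  have "finite {p. Poly_Mapping.lookup x p \<noteq> 0}" by simp
  then have "finite {p. r *\<^sub>R Poly_Mapping.lookup x p \<noteq> 0}" by (rule rev_finite_subset) auto
  then show ?thesis unfolding scaleR_poly_mapping_def by (subst Abs_poly_mapping_inverse) auto
qed

lemma mem_U_iff: "x \<in> U n \<longleftrightarrow> (\<forall>p. p \<notin> pairs n \<longrightarrow> Poly_Mapping.lookup x p = 0)"
  unfolding U_def by (auto simp: in_keys_iff)

lemma lookup_eq_0_if_U: "x \<in> U n \<Longrightarrow> p \<notin> pairs n \<Longrightarrow> Poly_Mapping.lookup x p = 0"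
  unfolding mem_U_iff by blast

lemma U_add: "x \<in> U n \<Longrightarrow> y \<in> U n \<Longrightarrow> x + y \<in> U n"
  by (simp add: mem_U_iff lookup_add)

lemma U_scaleR: "x \<in> U n \<Longrightarrow> r *\<^sub>R x \<in> U n"
  by (simp add: mem_U_iff lookup_scaleR)

lemma S_add: "S (x + y) d = S x d + S y d"
  by (induction d) (simp_all add: S_def lookup_add)

lemma S_scaleR: "S (r *\<^sub>R x) d = r * S x d"
  by (induction d) (simp_all add: S_def lookup_scaleR distrib_left)

lemma M_add: "M (\<lambda>j. a j + b j) d = M a d + M b d"
  unfolding M_def by (simp add: sum.distrib)

lemma M_mult: "M (\<lambda>j. N * b j) d = N * M b d"
  unfolding M_def by (simp add: sum_distrib_left)

lemma M_cong:
  assumes "dyck_path n d" "\<And>i. i \<in> {1..n - 1} \<Longrightarrow> a i = b i"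
  shows "M a d = M b d"
proof -
  have "hd d \<in> pairs n" "last d \<in> pairs n" using assms(1) unfolding dyck_path_def by auto
  then have "{fst (hd d)..fst (last d)} \<subseteq> {1..n - 1}" unfolding pairs_def by auto
  then show ?thesis unfolding M_def using assms(2) by (intro sum.cong) auto
qed

lemma P_cong: "(\<And>i. i \<in> {1..n - 1} \<Longrightarrow> a i = b i) \<Longrightarrow> P n a = P n b"
  unfolding P_def using M_cong[of n _ a b] by auto

lemma P_nonneg:
  assumes "x \<in> P n b"
  shows "0 \<le> Poly_Mapping.lookup x p"
proof (cases "p \<in> pairs n")
  case False
  have "x \<in> U n" using assms unfolding P_def by blast
  then show ?thesis using False by (simp add: lookup_eq_0_if_U)
qed (use assms in \<open>simp add: P_def\<close>)

lemma P_zero: "0 \<in> P n b"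
  using S_scaleR[of 0 0] unfolding P_def by (simp add: mem_U_iff)

lemma P_add:
  assumes "x \<in> P n a" "y \<in> P n b"
  shows "x + y \<in> P n (\<lambda>j. a j + b j)"
  using assms unfolding P_def
  by (auto simp: U_add lookup_add S_add M_add add_mono)

lemma P_scaleR: "x \<in> P n b \<Longrightarrow> real N *\<^sub>R x \<in> P n (\<lambda>j. N * b j)"
  unfolding P_def by (auto simp: U_scaleR lookup_scaleR S_scaleR M_mult mult_left_mono)

lemma P_scaleR_inverse: "x \<in> P n (\<lambda>j. N * b j) \<Longrightarrow> 0 < N \<Longrightarrow> (1 / real N) *\<^sub>R x \<in> P n b"
  unfolding P_def by (auto simp: U_scaleR lookup_scaleR S_scaleR M_mult field_simps)

lemma convex_P: "convex (P n b)"
proof (rule convexI)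
  fix x y and u v :: real
  assume xy: "x \<in> P n b" "y \<in> P n b" and uv: "0 \<le> u" "0 \<le> v" "u + v = 1"
  have "u * S x d + v * S y d \<le> real (M b d)" if "dyck_path n d" for d
    using xy that uv by (intro convex_bound_le) (auto simp: P_def)
  then show "u *\<^sub>R x + v *\<^sub>R y \<in> P n b"
    using xy uv unfolding P_def by (auto simp: U_add U_scaleR lookup_add lookup_scaleR S_add S_scaleR)
qed

section \<open>Partial weights, potentials and height functions\<close>

definition partial_weight :: "(nat \<Rightarrow> nat) \<Rightarrow> nat \<Rightarrow> real" where
  "partial_weight b k = (\<Sum>j\<in>{1..<k}. real (b j))"

text \<open>The last sum is \<open>M b d\<close> for a Dyck path from \<open>(s, s + 1)\<close> to
  \<open>(t, t + 1)\<close>, so path inequalities turn into comparisons with the heights of diagonal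
  pairs.\<close>

lemma partial_weight_split:
  assumes "1 \<le> s" "s \<le> t"
  shows "partial_weight b (Suc t) = partial_weight b s + real (\<Sum>i = s..t. b i)"
proof -
  have "{s..t} = {s..<Suc t}" by auto
  then show ?thesis unfolding partial_weight_def
    using sum.atLeastLessThan_concat[of 1 s "Suc t" "\<lambda>j. real (b j)"] assms by simp
qed

lemma partial_weight_mono: "k \<le> l \<Longrightarrow> partial_weight b k \<le> partial_weight b l"
  unfolding partial_weight_def by (intro sum_mono2) auto

lemma partial_weight_nonneg: "0 \<le> partial_weight b k"
  unfolding partial_weight_def by (simp add: sum_nonneg)

lemma partial_weight_add: "partial_weight (\<lambda>j. a j + b j) k = partial_weight a k + partial_weight b k"
  unfolding partial_weight_def by (simp add: sum.distrib)

lemma partial_weight_unit: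
  assumes "1 \<le> i"
  shows "partial_weight (\<lambda>j. of_bool (j = i)) k = of_bool (i < k)"
  using assms unfolding partial_weight_def by (simp add: of_bool_def if_distrib[of real] cong: if_cong)

text \<open>A certificate for membership: \<open>y\<close> grows by at least the entry of
  \<open>x\<close> at each step, so telescoping along a Dyck path bounds \<open>S x d\<close> by the
  difference of the diagonal values at its two ends. The potential need not be the height function
  of \<open>x\<close>.\<close>

lemma P_potentialI:
  assumes x: "x \<in> U n" "\<And>p. p \<in> pairs n \<Longrightarrow> 0 \<le> Poly_Mapping.lookup x p"
    and diag: "\<And>k. 1 \<le> k \<Longrightarrow> k \<le> n \<Longrightarrow> y k k = partial_weight b k"
    and right: "\<And>i j. (i, j) \<in> pairs n \<Longrightarrow> Poly_Mapping.lookup x (i, j) + y i (j - 1) \<le> y i j"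
    and up: "\<And>i j. (i, j) \<in> pairs n \<Longrightarrow> 2 \<le> i \<Longrightarrow> Poly_Mapping.lookup x (i, j) + y (i - 1) j \<le> y i j"
    and top: "\<And>i. 1 \<le> i \<Longrightarrow> i < n \<Longrightarrow> y i (i + 1) \<le> partial_weight b (i + 1)"
  shows "x \<in> P n b"
proof -
  have "S x d \<le> real (M b d)" if "dyck_path n d" for d
  proof -
    have d: "d \<noteq> []" "set d \<subseteq> pairs n" "snd (hd d) = fst (hd d) + 1" "snd (last d) = fst (last d) + 1"
      and step: "\<And>k. k + 1 < length d \<Longrightarrow> d ! (k + 1) = (fst (d ! k) + 1, snd (d ! k)) \<or>
          d ! (k + 1) = (fst (d ! k), snd (d ! k) + 1)"
      using that unfolding dyck_path_def by auto
    define s where "s = fst (hd d)"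
    have hd: "hd d = (s, s + 1)" using d(3) unfolding s_def by (metis prod.collapse)
    have s: "1 \<le> s" "s + 1 \<le> n" using d(1,2) hd hd_in_set[OF d(1)] unfolding pairs_def by auto
    \<comment> \<open>The first pair \<open>(s, s + 1)\<close> is entered from the diagonal pair
      \<open>(s, s)\<close>, whose value is \<open>partial_weight b s\<close>; every later step uses
      \<open>right\<close> or \<open>up\<close>.\<close>
    have inv: "s \<le> fst (d ! k) \<and> partial_weight b s + S x (take (Suc k) d) \<le> y (fst (d ! k)) (snd (d ! k))"
      if "k < length d" for k
      using that
    proof (induction k)
      case 0
      have "d ! 0 = (s, s + 1)" using d(1) hd by (simp add: hd_conv_nth)
      moreover have "take (Suc 0) d = [(s, s + 1)]" using d(1) hd by (simp add: take_Suc)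
      moreover have "(s, s + 1) \<in> pairs n" using s by (simp add: pairs_def)
      ultimately show ?case using right[of s "s + 1"] diag[of s] s by (simp add: S_def)
    next
      case (Suc k)
      obtain i j where ij: "d ! k = (i, j)" by fastforce
      have IH: "s \<le> i" "partial_weight b s + S x (take (Suc k) d) \<le> y i j" using Suc ij by auto
      have mem: "d ! Suc k \<in> pairs n" using Suc.prems d(2) nth_mem by blast
      have S: "S x (take (Suc (Suc k)) d) = S x (take (Suc k) d) + Poly_Mapping.lookup x (d ! Suc k)"
        using Suc.prems by (simp add: take_Suc_conv_app_nth[of "Suc k"] S_def)
      from step[of k] Suc.prems ij consider "d ! Suc k = (i + 1, j)" | "d ! Suc k = (i, j + 1)" by auto
      then show ?case
      proof cases
        case 1
        then show ?thesis using up[of "i + 1" j] mem IH S s by simp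
      next
        case 2
        then show ?thesis using right[of i "j + 1"] mem IH S s by simp
      qed
    qed
    define t where "t = fst (last d)"
    have last: "last d = (t, t + 1)" using d(4) unfolding t_def by (metis prod.collapse)
    have t: "1 \<le> t" "t < n" using d(1,2) last last_in_set[OF d(1)] unfolding pairs_def by auto
    have "d ! (length d - 1) = (t, t + 1)" using d(1) last by (simp add: last_conv_nth)
    then have "s \<le> t" "partial_weight b s + S x d \<le> y t (t + 1)" using inv[of "length d - 1"] d(1) by auto
    moreover have "M b d = (\<Sum>i = s..t. b i)" unfolding M_def hd last by simp
    ultimately show ?thesis using top[OF t] partial_weight_split[OF s(1), of t b] by simp
  qed
  then show ?thesis unfolding P_def using x by blast
qed

text \<open>
  The value \<open>0\<close> in row \<open>0\<close> never exceeds the other argument of the maximum, since heights are nonnegative.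
\<close>

function height :: "(nat \<Rightarrow> nat) \<Rightarrow> point \<Rightarrow> nat \<Rightarrow> nat \<Rightarrow> real" where
  "height b x i j =
     (if i = 0 then 0
      else if j \<le> i then partial_weight b i
      else Poly_Mapping.lookup x (i, j) + max (height b x (i - 1) j) (height b x i (j - 1)))"
  by auto
termination by (relation "Wellfounded.measure (\<lambda>(b, x, i, j). i + j)") auto

declare height.simps [simp del]

lemma height_0: "height b x 0 j = 0"
  by (simp add: height.simps)

lemma height_diag: "height b x k k = partial_weight b k"
  by (simp add: height.simps partial_weight_def)

lemma height_step:
  "1 \<le> i \<Longrightarrow> i < j \<Longrightarrow>
   height b x i j = Poly_Mapping.lookup x (i, j) + max (height b x (i - 1) j) (height b x i (j - 1))"
  by (subst height.simps) simp

lemma height_nonneg: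
  assumes "\<And>p. 0 \<le> Poly_Mapping.lookup x p"
  shows "0 \<le> height b x i j"
proof (induction "i + j" arbitrary: i j rule: less_induct)
  case less
  show ?case
  proof (cases "i = 0 \<or> j \<le> i")
    case True
    then show ?thesis by (subst height.simps) (auto simp: partial_weight_nonneg)
  next
    case False
    then have "0 \<le> height b x (i - 1) j" by (intro less) auto
    then show ?thesis using False assms[of "(i, j)"] height_step[of i j b x] by auto
  qed
qed

lemma height_mono_right:
  assumes "\<And>p. 0 \<le> Poly_Mapping.lookup x p" "i \<le> j" "j \<le> j'"
  shows "height b x i j \<le> height b x i j'"
proof (cases "i = 0")
  case True
  then show ?thesis by (simp add: height_0)
next
  case False
  from assms(3) show ?thesis
  proof (induction rule: dec_induct)
    case (step k)
    then show ?case using height_step[of i "Suc k" b x] assms(1)[of "(i, Suc k)"] assms(2) False by auto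
  qed simp
qed

text \<open>The range stops short of the diagonal: the recursion does not relate
  \<open>(j - 1, j)\<close> to \<open>(j, j)\<close>, and comparing these two heights takes the Dyck
  path inequalities.\<close>

lemma height_mono_up:
  assumes "\<And>p. 0 \<le> Poly_Mapping.lookup x p" "i \<le> i'" "i' < j"
  shows "height b x i j \<le> height b x i' j"
  using assms(2,3)
proof (induction rule: dec_induct)
  case (step k)
  then show ?case using height_step[of "Suc k" j b x] assms(1)[of "(Suc k, j)"] by auto
qed simp

text \<open>Following the larger argument of the maximum backwards from \<open>(i, j)\<close> traces
  a path that starts next to the diagonal and realises the height. It is a Dyck path except that its
  end may be away from the diagonal.\<close>

lemma height_path:
  assumes nn: "\<And>p. 0 \<le> Poly_Mapping.lookup x p" and "(i, j) \<in> pairs n"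
  shows "\<exists>d. d \<noteq> [] \<and> set d \<subseteq> pairs n \<and> snd (hd d) = fst (hd d) + 1 \<and> last d = (i, j) \<and>
     fst (hd d) \<le> i \<and>
     (\<forall>k. k + 1 < length d \<longrightarrow>
        d ! (k + 1) = (fst (d ! k) + 1, snd (d ! k)) \<or> d ! (k + 1) = (fst (d ! k), snd (d ! k) + 1)) \<and>
     height b x i j = partial_weight b (fst (hd d)) + S x d"
    (is "\<exists>d. ?path d i j")
  using assms(2)
proof (induction "i + j" arbitrary: i j rule: less_induct)
  case less
  have ij: "1 \<le> i" "i < j" "j \<le> n" using less.prems by (auto simp: pairs_def)
  note h = height_step[OF ij(1,2), of b x]
  have extend: "\<exists>d. ?path d i j"
    if d: "?path d i' j'" and "(i, j) = (i' + 1, j') \<or> (i, j) = (i', j' + 1)"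
      and hh: "height b x i j = Poly_Mapping.lookup x (i, j) + height b x i' j'" for d i' j'
  proof (rule exI[of _ "d @ [(i, j)]"], intro conjI allI impI)
    fix k assume k: "k + 1 < length (d @ [(i, j)])"
    show "(d @ [(i, j)]) ! (k + 1) = (fst ((d @ [(i, j)]) ! k) + 1, snd ((d @ [(i, j)]) ! k)) \<or>
        (d @ [(i, j)]) ! (k + 1) = (fst ((d @ [(i, j)]) ! k), snd ((d @ [(i, j)]) ! k) + 1)"
    proof (cases "k + 1 < length d")
      case True
      then show ?thesis using d by (simp add: nth_append)
    next
      case False
      then have last: "k = length d - 1" "k + 1 = length d" using k by auto
      moreover have "d \<noteq> []" "last d = (i', j')" using d by blast+
      ultimately have "d ! k = (i', j')" by (simp add: last_conv_nth)
      then show ?thesis using that(2) last(2) by (auto simp: nth_append)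
    qed
  qed (use d hh less.prems that(2) in \<open>auto simp: S_def\<close>)
  show ?case
  proof (cases "height b x (i - 1) j \<le> height b x i (j - 1)")
    case True
    then have hh: "height b x i j = Poly_Mapping.lookup x (i, j) + height b x i (j - 1)" using h by simp
    show ?thesis
    \<comment> \<open>Here the predecessor \<open>(i, i)\<close> is diagonal: it contributes
      \<open>partial_weight b i\<close>, and the path starts at \<open>(i, j)\<close>
      itself.\<close>
    proof (cases "j = i + 1")
      case True
      then have "?path [(i, j)] i j" using hh less.prems by (simp add: height_diag S_def)
      then show ?thesis by blast
    next
      case False
      then have "(i, j - 1) \<in> pairs n" using ij by (auto simp: pairs_def)
      then obtain d where "?path d i (j - 1)" using less.hyps[of i "j - 1"] ij by auto
      then show ?thesis using extend[of d i "j - 1"] hh ij by auto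
    qed
  next
    case False
    \<comment> \<open>Ties are resolved towards \<open>(i, j - 1)\<close>, so the height in row
      \<open>i - 1\<close> strictly exceeds a nonnegative number, which excludes row
      \<open>0\<close>.\<close>
    then have "height b x (i - 1) j \<noteq> 0" using height_nonneg[OF nn, of b i "j - 1"] by linarith
    then have i: "i - 1 \<noteq> 0" by (metis height_0)
    have hh: "height b x i j = Poly_Mapping.lookup x (i, j) + height b x (i - 1) j" using h False by simp
    have "(i - 1, j) \<in> pairs n" using ij i by (auto simp: pairs_def)
    then obtain d where "?path d (i - 1) j" using less.hyps[of "i - 1" j] ij by auto
    then show ?thesis using extend[of d "i - 1" j] hh ij by auto
  qed
qed

text \<open>A path realising the height at \<open>(j - 1, j)\<close> is a Dyck path, and its
  inequality is the bound there; smaller first indices follow by monotonicity.\<close>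

lemma height_le_partial_weight:
  assumes x: "x \<in> P n b" and "(i, j) \<in> pairs n"
  shows "height b x i j \<le> partial_weight b j"
proof -
  note nn = P_nonneg[OF x]
  have ij: "1 \<le> i" "i < j" "j \<le> n" using assms(2) by (auto simp: pairs_def)
  define t where "t = j - 1"
  have t: "j = Suc t" "1 \<le> t" "i \<le> t" "(t, Suc t) \<in> pairs n" using ij by (auto simp: t_def pairs_def)
  from height_path[OF nn t(4), of b] obtain d where d: "d \<noteq> []" "set d \<subseteq> pairs n"
    "snd (hd d) = fst (hd d) + 1" "last d = (t, Suc t)" "fst (hd d) \<le> t"
     "\<forall>k. k + 1 < length d \<longrightarrow>
        d ! (k + 1) = (fst (d ! k) + 1, snd (d ! k)) \<or> d ! (k + 1) = (fst (d ! k), snd (d ! k) + 1)"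
    and h: "height b x t (Suc t) = partial_weight b (fst (hd d)) + S x d" by blast
  have "dyck_path n d" unfolding dyck_path_def using d by simp
  then have "S x d \<le> real (M b d)" using x unfolding P_def by blast
  moreover have "1 \<le> fst (hd d)" using hd_in_set[OF d(1)] d(2) by (auto simp: pairs_def)
  ultimately have "height b x t (Suc t) \<le> partial_weight b (Suc t)"
    using h partial_weight_split[of "fst (hd d)" t b] d(4,5) by (simp add: M_def)
  moreover have "height b x i j \<le> height b x t j" using t ij by (intro height_mono_up nn) auto
  ultimately show ?thesis unfolding t(1) by linarith
qed


section \<open>Antichain indicators and splitting off a unit weight\<close>

definition antichain_points :: "nat \<Rightarrow> nat \<Rightarrow> point set" where
  "antichain_points n i = chi ` {A. A \<subseteq> Q n i \<and> antichain A}"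

lemma finite_antichain_points: "finite (antichain_points n i)"
  unfolding antichain_points_def by (intro finite_imageI finite_subset[OF _ finite_Pow_iff[THEN iffD2, OF finite_Q]]) auto

lemma antichain_points_nonempty: "antichain_points n i \<noteq> {}"
  unfolding antichain_points_def antichain_def by blast

lemma finite_pairs: "finite (pairs n)"
  by (rule finite_subset[of _ "{..n} \<times> {..n}"]) (auto simp: pairs_def)

text \<open>The potential is the indicator of the up-set generated by \<open>A\<close>, joined with
  the rows beyond \<open>i\<close> so that the diagonal values are right. As \<open>A\<close> is an
  antichain inside \<open>Q n i\<close>, its pairs are minimal there, so the potential jumps from 0
  to 1 at each of them.\<close>

lemma chi_in_P:
  assumes i: "i \<in> {1..n - 1}" and A: "A \<subseteq> Q n i" "antichain A"
  shows "chi A \<in> P n (\<lambda>j. of_bool (j = i))"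
proof -
  have fin: "finite A" using A(1) finite_Q by (rule finite_subset)
  have AQ: "fst p \<le> i" "i < snd p" "p \<in> pairs n" if "p \<in> A" for p
    using that A(1) by (auto simp: Q_def pairs_def)
  have anti: "p = q" if "p \<in> A" "q \<in> A" "p \<preceq> q" for p q using that A(2) unfolding antichain_def by blast
  define y :: "nat \<Rightarrow> nat \<Rightarrow> real" where "y k l = of_bool (i < k \<or> (\<exists>p\<in>A. p \<preceq> (k, l)))" for k l
  have step: "indicator A (k, l) + y k' l' \<le> y k l"
    if "k' \<le> k" "l' \<le> l" "(k', l') \<noteq> (k, l)" for k l k' l'
  proof (cases "(k, l) \<in> A")
    case True
    have "\<not> i < k'" using AQ(1)[OF True] that by simp
    moreover have "\<not> (\<exists>p\<in>A. p \<preceq> (k', l'))"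
    proof
      assume "\<exists>p\<in>A. p \<preceq> (k', l')"
      then obtain p where p: "p \<in> A" "p \<preceq> (k', l')" by blast
      then have "p \<preceq> (k, l)" using that by (auto simp: pair_le_def)
      then have "p = (k, l)" using anti p True by blast
      then show False using p that by (auto simp: pair_le_def)
    qed
    moreover have "\<exists>p\<in>A. p \<preceq> (k, l)" using True by (intro bexI[of _ "(k, l)"]) (auto simp: pair_le_def)
    ultimately show ?thesis using True by (simp add: y_def)
  next
    case False
    have "p \<preceq> (k, l)" if "p \<preceq> (k', l')" for p
      using that \<open>k' \<le> k\<close> \<open>l' \<le> l\<close> by (auto simp: pair_le_def)
    then have "i < k \<or> (\<exists>p\<in>A. p \<preceq> (k, l))" if "i < k' \<or> (\<exists>p\<in>A. p \<preceq> (k', l'))"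
      using that \<open>k' \<le> k\<close> less_le_trans[of i k' k] by blast
    then have "y k' l' \<le> y k l" unfolding y_def by (simp add: of_bool_def)
    then show ?thesis using False by simp
  qed
  have none: "\<not> (\<exists>p\<in>A. p \<preceq> (k, l))" if "l \<le> i" for k l
    using AQ(2) that by (force simp: pair_le_def)
  show ?thesis
  proof (rule P_potentialI[where y = y])
    show "chi A \<in> U n" using AQ(3) unfolding mem_U_iff lookup_chi[OF fin] indicator_def by auto
    show "y k k = partial_weight (\<lambda>j. of_bool (j = i)) k" for k
      using none[of k k] i by (cases "k \<le> i") (simp_all add: y_def partial_weight_unit)
    show "Poly_Mapping.lookup (chi A) (k, l) + y k (l - 1) \<le> y k l" if "(k, l) \<in> pairs n" for k l
      using step[of k k "l - 1" l] that by (auto simp: lookup_chi[OF fin] pairs_def)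
    show "Poly_Mapping.lookup (chi A) (k, l) + y (k - 1) l \<le> y k l" if "2 \<le> k" for k l
      using step[of "k - 1" k l l] that by (auto simp: lookup_chi[OF fin])
    show "y k (k + 1) \<le> partial_weight (\<lambda>j. of_bool (j = i)) (k + 1)" for k
      using none[of "k + 1" k] i by (cases "k + 1 \<le> i") (simp_all add: y_def partial_weight_unit)
  qed (simp add: lookup_chi[OF fin])
qed

text \<open>Averaging the layers \<open>m p \<le> t < y p\<close> over \<open>t\<close> between
  \<open>c\<close> and \<open>c + \<beta>\<close> measures the part of each interval from
  \<open>m p\<close> to \<open>y p\<close> inside that window. A layer changes only at the finitely
  many values in \<open>T\<close>, so induction on their number replaces an integral; \<beta> is
  variable to let the window shrink.\<close>

lemma layer_cake:
  fixes y m :: "nat \<times> nat \<Rightarrow> real"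
  assumes my: "\<And>p. p \<in> pairs n \<Longrightarrow> m p \<le> y p"
    and layer: "\<And>t. c \<le> t \<Longrightarrow> t < c + 1 \<Longrightarrow> {p \<in> pairs n. m p \<le> t \<and> t < y p} \<in> F"
    and "0 < \<beta>" "\<beta> \<le> 1"
  shows "\<exists>u \<in> convex hull (chi ` F). \<forall>p. \<beta> * Poly_Mapping.lookup u p =
    (if p \<in> pairs n then min (max (y p) c) (c + \<beta>) - min (max (m p) c) (c + \<beta>) else 0)"
proof -
  define T where "T = y ` pairs n \<union> m ` pairs n"
  have T: "finite T" unfolding T_def using finite_pairs by blast
  have fin: "finite {p \<in> pairs n. m p \<le> t \<and> t < y p}" for t using finite_pairs by simp
  show ?thesis using assms(3,4)
  proof (induction "card {t \<in> T. c < t \<and> t < c + \<beta>}" arbitrary: \<beta> rule: less_induct)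
    case less
    let ?B = "{t \<in> T. c < t \<and> t < c + \<beta>}"
    have finB: "finite ?B" using T by simp
    show ?case
    proof (cases "?B = {}")
      case True
      \<comment> \<open>With no value of \<open>T\<close> strictly inside the window, the layer at
        \<open>t = c\<close> represents all of it.\<close>
      have "\<beta> * Poly_Mapping.lookup (chi {p \<in> pairs n. m p \<le> c \<and> c < y p}) p =
        (if p \<in> pairs n then min (max (y p) c) (c + \<beta>) - min (max (m p) c) (c + \<beta>) else 0)" for p
      proof (cases "p \<in> pairs n")
        case p: True
        then have "y p \<le> c \<or> c + \<beta> \<le> y p" "m p \<le> c \<or> c + \<beta> \<le> m p" using True unfolding T_def by force+
        then show ?thesis using my[OF p] p less.prems
          by (auto simp: lookup_chi[OF fin] indicator_def min_def max_def)
      qed (simp add: lookup_chi[OF fin])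
      moreover have "chi {p \<in> pairs n. m p \<le> c \<and> c < y p} \<in> convex hull (chi ` F)"
        using layer[of c] by (intro hull_inc) auto
      ultimately show ?thesis by blast
    next
      case False
      \<comment> \<open>The window is cut at the largest value of \<open>T\<close> inside it: the
        layer is constant on the last piece, and the induction hypothesis covers the rest. The
        convex weights below are the relative lengths of the two pieces.\<close>
      define \<alpha> where "\<alpha> = Max ?B - c"
      have \<alpha>B: "c + \<alpha> \<in> ?B" using Max_in[OF finB False] unfolding \<alpha>_def by simp
      then have \<alpha>: "0 < \<alpha>" "\<alpha> < \<beta>" by auto
      have gap: "t \<le> c + \<alpha> \<or> c + \<beta> \<le> t" if "t \<in> T" for t
      proof (rule ccontr)
        assume *: "\<not> (t \<le> c + \<alpha> \<or> c + \<beta> \<le> t)"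
        then have "t \<in> ?B" using that \<alpha> by auto
        then have "t \<le> c + \<alpha>" using Max_ge[OF finB] unfolding \<alpha>_def by simp
        then show False using * by simp
      qed
      have "{t \<in> T. c < t \<and> t < c + \<alpha>} \<subseteq> ?B" using \<alpha> by auto
      moreover have "c + \<alpha> \<notin> {t \<in> T. c < t \<and> t < c + \<alpha>}" by simp
      ultimately have "{t \<in> T. c < t \<and> t < c + \<alpha>} \<subset> ?B" using \<alpha>B by blast
      then have "card {t \<in> T. c < t \<and> t < c + \<alpha>} < card ?B" by (rule psubset_card_mono[OF finB])
      moreover have "\<alpha> \<le> 1" using \<alpha> less.prems by simp
      ultimately obtain u where u: "u \<in> convex hull (chi ` F)"
        and lu: "\<And>p. \<alpha> * Poly_Mapping.lookup u p =
          (if p \<in> pairs n then min (max (y p) c) (c + \<alpha>) - min (max (m p) c) (c + \<alpha>) else 0)"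
        using less.hyps[of \<alpha>] \<alpha>(1) by blast
      define w where "w = chi {p \<in> pairs n. m p \<le> c + \<alpha> \<and> c + \<alpha> < y p}"
      have w: "w \<in> convex hull (chi ` F)"
        unfolding w_def using layer[of "c + \<alpha>"] \<alpha> less.prems by (intro hull_inc) auto
      have "(\<alpha> / \<beta>) *\<^sub>R u + (1 - \<alpha> / \<beta>) *\<^sub>R w \<in> convex hull (chi ` F)"
        using u w \<alpha> by (intro convexD[OF convex_convex_hull]) auto
      moreover have "\<beta> * Poly_Mapping.lookup ((\<alpha> / \<beta>) *\<^sub>R u + (1 - \<alpha> / \<beta>) *\<^sub>R w) p =
          (if p \<in> pairs n then min (max (y p) c) (c + \<beta>) - min (max (m p) c) (c + \<beta>) else 0)" for p
      proof -
        have "\<beta> * Poly_Mapping.lookup ((\<alpha> / \<beta>) *\<^sub>R u + (1 - \<alpha> / \<beta>) *\<^sub>R w) p =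
            \<alpha> * Poly_Mapping.lookup u p + (\<beta> - \<alpha>) * Poly_Mapping.lookup w p"
          using less.prems by (simp add: lookup_add lookup_scaleR field_simps)
        also have "\<dots> = (if p \<in> pairs n then min (max (y p) c) (c + \<beta>) - min (max (m p) c) (c + \<beta>) else 0)"
        proof (cases "p \<in> pairs n")
          case p: True
          then have "y p \<le> c + \<alpha> \<or> c + \<beta> \<le> y p" "m p \<le> c + \<alpha> \<or> c + \<beta> \<le> m p"
            using gap unfolding T_def by auto
          then show ?thesis using my[OF p] p \<alpha> unfolding lu w_def
            by (auto simp: lookup_chi[OF fin] indicator_def min_def max_def)
        qed (simp add: lu w_def lookup_chi[OF fin])
        finally show ?thesis .
      qed
      ultimately show ?thesis by blast
    qed
  qed
qed

text \<open>The diagonal heights up to \<open>i\<close> are at most \<open>c\<close> and the later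
  ones at least \<open>c + 1\<close>. The part of the heights inside this window yields
  \<open>u\<close> by \<open>layer_cake\<close>; collapsing the window leaves a potential for
  \<open>x - u\<close> with the diagonal values of \<open>a\<close>.\<close>

lemma P_unit_decompose:
  assumes i: "i \<in> {1..n - 1}" and x: "x \<in> P n (\<lambda>j. a j + of_bool (j = i))"
  shows "\<exists>x'\<in>P n a. \<exists>u\<in>convex hull (antichain_points n i). x = x' + u"
proof -
  define b where "b = (\<lambda>j. a j + of_bool (j = i))"
  define h where "h = height b x"
  define c where "c = partial_weight a i"
  define y where "y p = h (fst p) (snd p)" for p
  define m where "m p = max (h (fst p - 1) (snd p)) (h (fst p) (snd p - 1))" for p
  have xb: "x \<in> P n b" using x unfolding b_def .
  have xU: "x \<in> U n" using xb unfolding P_def by blast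
  note nn = P_nonneg[OF xb]
  have lx: "Poly_Mapping.lookup x p = y p - m p" if "p \<in> pairs n" for p
    using that height_step[of "fst p" "snd p" b x] by (auto simp: pairs_def y_def m_def h_def)
  have my: "m p \<le> y p" if "p \<in> pairs n" for p using lx[OF that] nn[of p] by simp
  have pw: "partial_weight b k = partial_weight a k + of_bool (i < k)" for k
    unfolding b_def partial_weight_add using i by (subst partial_weight_unit) auto
  have below: "partial_weight b k \<le> c" if "k \<le> i" for k
    using that partial_weight_mono[of k i a] by (simp add: pw c_def)
  have above: "c + 1 \<le> partial_weight b k" if "i < k" for k
    using that partial_weight_mono[of i k a] by (simp add: pw c_def)
  have upper: "h k l \<le> partial_weight b l" if "(k, l) \<in> pairs n" for k l
    unfolding h_def by (rule height_le_partial_weight[OF xb that])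
  \<comment> \<open>Columns up to \<open>i\<close> have no height above \<open>c\<close>, and in
    rows beyond \<open>i\<close> the preceding height is already at least \<open>c + 1\<close>; this
    confines a layer to \<open>Q n i\<close>. If \<open>p\<close> strictly precedes
    \<open>q\<close>, the height at \<open>p\<close> is at most \<open>m q\<close>, so both cannot
    lie in one layer.\<close>
  have layer: "{p \<in> pairs n. m p \<le> t \<and> t < y p} \<in> {A. A \<subseteq> Q n i \<and> antichain A}"
    if t: "c \<le> t" "t < c + 1" for t
  proof (intro CollectI conjI subsetI)
    fix p assume "p \<in> {p \<in> pairs n. m p \<le> t \<and> t < y p}"
    moreover obtain k l where p: "p = (k, l)" by fastforce
    ultimately have kl: "(k, l) \<in> pairs n" "m (k, l) \<le> t" "t < h k l" by (auto simp: y_def)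
    have "i < l" using upper[OF kl(1)] below[of l] kl t by (cases "i < l") auto
    moreover have "k \<le> i"
    proof (rule ccontr)
      assume "\<not> k \<le> i"
      then have "c + 1 \<le> h k k" using above by (simp add: h_def height_diag)
      also have "\<dots> \<le> h k (l - 1)" unfolding h_def using kl by (intro height_mono_right nn) (auto simp: pairs_def)
      also have "\<dots> \<le> m (k, l)" by (simp add: m_def)
      finally show False using kl t by simp
    qed
    ultimately show "p \<in> Q n i" using kl(1) p by (auto simp: Q_def pairs_def)
  next
    show "antichain {p \<in> pairs n. m p \<le> t \<and> t < y p}"
      unfolding antichain_def
    proof (intro ballI impI, rule ccontr)
      fix p q assume pq: "p \<in> {p \<in> pairs n. m p \<le> t \<and> t < y p}" "q \<in> {p \<in> pairs n. m p \<le> t \<and> t < y p}"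
        and le: "p \<preceq> q" and ne: "p \<noteq> q"
      obtain k l k' l' where kl: "p = (k, l)" "q = (k', l')" by fastforce
      have r: "1 \<le> k" "k < l" "l \<le> l'" "k \<le> k'" "k' < l'"
        using pq le unfolding kl by (auto simp: pairs_def pair_le_def)
      have "h k l \<le> m q"
      proof (cases "k = k'")
        case True
        then have "l \<le> l' - 1" using ne r kl by auto
        then have "h k l \<le> h k (l' - 1)" unfolding h_def using r by (intro height_mono_right nn) auto
        then show ?thesis using True by (simp add: kl m_def)
      next
        case False
        have "h k l \<le> h k l'" unfolding h_def using r by (intro height_mono_right nn) auto
        also have "\<dots> \<le> h (k' - 1) l'" unfolding h_def using r False by (intro height_mono_up nn) auto
        finally show ?thesis by (simp add: kl m_def)
      qed
      then show False using pq by (simp add: kl y_def)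
    qed
  qed
  obtain u where u: "u \<in> convex hull (antichain_points n i)"
    and lu: "\<And>p. Poly_Mapping.lookup u p =
      (if p \<in> pairs n then min (max (y p) c) (c + 1) - min (max (m p) c) (c + 1) else 0)"
    using layer_cake[of n m y c "{A. A \<subseteq> Q n i \<and> antichain A}" 1, OF my layer]
    unfolding antichain_points_def by auto
  \<comment> \<open>\<open>g\<close> fixes values up to \<open>c\<close>, sends the window to
    \<open>c\<close> and lowers larger values by 1. Being monotone, it preserves the inequalities
    between heights.\<close>
  define g where "g r = r - (min (max r c) (c + 1) - c)" for r
  have g_mono: "g r \<le> g s" if "r \<le> s" for r s using that unfolding g_def by (auto simp: min_def max_def)
  have g_pw: "g (partial_weight b k) = partial_weight a k" for k
    using below[of k] above[of k] pw[of k] by (cases "k \<le> i") (auto simp: g_def min_def max_def)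
  have lookup_diff: "Poly_Mapping.lookup (x - u) p = (if p \<in> pairs n then g (y p) - g (m p) else 0)" for p
    using lookup_eq_0_if_U[OF xU, of p] lx[of p] by (auto simp: lookup_minus lu g_def)
  have "x - u \<in> P n a"
  proof (rule P_potentialI[where y = "\<lambda>k l. g (h k l)"])
    show "x - u \<in> U n" by (simp add: mem_U_iff lookup_diff)
    show "0 \<le> Poly_Mapping.lookup (x - u) p" if "p \<in> pairs n" for p
      using g_mono[OF my[OF that]] by (simp add: lookup_diff)
    show "g (h k k) = partial_weight a k" for k by (simp add: h_def height_diag g_pw)
    show "Poly_Mapping.lookup (x - u) (k, l) + g (h k (l - 1)) \<le> g (h k l)" if "(k, l) \<in> pairs n" for k l
      using that g_mono[of "h k (l - 1)" "m (k, l)"] by (simp add: lookup_diff y_def m_def)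
    show "Poly_Mapping.lookup (x - u) (k, l) + g (h (k - 1) l) \<le> g (h k l)" if "(k, l) \<in> pairs n" for k l
      using that g_mono[of "h (k - 1) l" "m (k, l)"] by (simp add: lookup_diff y_def m_def)
    show "g (h k (k + 1)) \<le> partial_weight a (k + 1)" if "1 \<le> k" "k < n" for k
      using g_mono[OF upper[of k "k + 1"]] that by (simp add: g_pw pairs_def)
  qed
  then show ?thesis using u by (metis diff_add_cancel)
qed

text \<open>All heights are squeezed between 0 and a vanishing partial weight.\<close>

lemma P_eq_0:
  assumes "x \<in> P n (\<lambda>j. 0)"
  shows "x = 0"
proof (rule poly_mapping_eqI)
  fix p
  have xU: "x \<in> U n" using assms unfolding P_def by blast
  note nn = P_nonneg[OF assms]
  show "Poly_Mapping.lookup x p = Poly_Mapping.lookup 0 p"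
  proof (cases "p \<in> pairs n")
    case True
    obtain k l where p: "p = (k, l)" by fastforce
    have kl: "1 \<le> k" "k < l" using True p by (auto simp: pairs_def)
    have "height (\<lambda>j. 0) x k l \<le> 0"
      using height_le_partial_weight[OF assms, of k l] True p by (simp add: partial_weight_def)
    then have "Poly_Mapping.lookup x (k, l) \<le> 0"
      using height_step[OF kl, of "\<lambda>j. 0" x] height_nonneg[OF nn, of "\<lambda>j. 0" k "l - 1"] by simp
    then show ?thesis using nn[of p] p by simp
  qed (simp add: lookup_eq_0_if_U[OF xU])
qed

section \<open>Vertices as weighted sums of antichain indicators\<close>

lemma sum_chi_in_P:
  assumes A: "\<And>i. i \<in> {1..n - 1} \<Longrightarrow> A i \<subseteq> Q n i \<and> antichain (A i)"
  shows "(\<Sum>i = 1..n - 1. real (c i) *\<^sub>R chi (A i)) \<in> P n c"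
proof -
  have "(\<Sum>i\<in>I. real (c i) *\<^sub>R chi (A i)) \<in> P n (\<lambda>j. if j \<in> I then c j else 0)"
    if "finite I" "I \<subseteq> {1..n - 1}" for I
    using that
  proof (induction I)
    case empty
    then show ?case by (simp add: P_zero)
  next
    case (insert i I)
    have "real (c i) *\<^sub>R chi (A i) \<in> P n (\<lambda>j. c i * of_bool (j = i))"
      using insert.prems A by (intro P_scaleR chi_in_P) auto
    from P_add[OF this insert.IH] insert
    have "(\<Sum>i\<in>insert i I. real (c i) *\<^sub>R chi (A i)) \<in>
        P n (\<lambda>j. c i * of_bool (j = i) + (if j \<in> I then c j else 0))" by simp
    also have "\<dots> = P n (\<lambda>j. if j \<in> insert i I then c j else 0)"
      using insert.hyps by (intro P_cong) auto
    finally show ?case .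
  qed
  from this[of "{1..n - 1}"] have "(\<Sum>i = 1..n - 1. real (c i) *\<^sub>R chi (A i)) \<in>
      P n (\<lambda>j. if j \<in> {1..n - 1} then c j else 0)" by simp
  also have "\<dots> = P n c" by (intro P_cong) auto
  finally show ?thesis .
qed

text \<open>For large \<open>N\<close>, a translate of \<open>P n a\<close> lies in \<open>N\<close> times \<open>P n b\<close>.\<close>

lemma extreme_point_sum_chi_support:
  assumes A: "\<And>i. i \<in> {1..n - 1} \<Longrightarrow> A i \<subseteq> Q n i \<and> antichain (A i)"
    and ext: "(\<Sum>i = 1..n - 1. real (b i) *\<^sub>R chi (A i)) extreme_point_of P n b"
    and supp: "\<And>i. i \<in> {1..n - 1} \<Longrightarrow> 0 < a i \<Longrightarrow> 0 < b i"
  shows "(\<Sum>i = 1..n - 1. real (a i) *\<^sub>R chi (A i)) extreme_point_of P n a"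
proof -
  \<comment> \<open>\<open>N\<close> exceeds every \<open>a i\<close>, so
    \<open>N * b i - a i\<close> is a true difference wherever \<open>b i\<close> is positive;
    elsewhere \<open>a i\<close> is 0 by \<open>supp\<close>.\<close>
  define N where "N = Suc (\<Sum>i = 1..n - 1. a i)"
  let ?v = "\<lambda>c. \<Sum>i = 1..n - 1. real (c i) *\<^sub>R chi (A i)"
  define r where "r = ?v (\<lambda>i. N * b i - a i)"
  have N: "0 < N" by (simp add: N_def)
  have le: "a i \<le> N * b i" if "i \<in> {1..n - 1}" for i
  proof (cases "a i = 0")
    case False
    have "a i \<le> (\<Sum>i = 1..n - 1. a i)" using that by (intro member_le_sum) auto
    then have "a i \<le> N * 1" by (simp add: N_def)
    also have "\<dots> \<le> N * b i" using supp[OF that] False by (intro mult_le_mono2) auto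
    finally show ?thesis .
  qed simp
  \<comment> \<open>Translating by \<open>r\<close> and dividing by \<open>N\<close> is an injective
    affine map from \<open>P n a\<close> into \<open>P n b\<close> that sends \<open>?v a\<close> to
    \<open>?v b\<close>, so extremality pulls back along it.\<close>
  have rP: "(1 / real N) *\<^sub>R (r + p) \<in> P n b" if "p \<in> P n a" for p
  proof -
    have "r + p \<in> P n (\<lambda>j. (N * b j - a j) + a j)" unfolding r_def by (intro P_add sum_chi_in_P A that) auto
    also have "\<dots> = P n (\<lambda>j. N * b j)" using le by (intro P_cong) auto
    finally show ?thesis using P_scaleR_inverse N by blast
  qed
  have "r + ?v a = real N *\<^sub>R ?v b"
    unfolding r_def scaleR_sum_right sum.distrib[symmetric]
    by (intro sum.cong) (auto simp: le of_nat_diff simp flip: scaleR_add_left)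
  then have vb: "?v b = (1 / real N) *\<^sub>R (r + ?v a)" using N by simp
  show ?thesis unfolding extreme_point_of_iff
  proof (intro conjI ballI allI impI)
    show "?v a \<in> P n a" by (intro sum_chi_in_P A)
    fix p q and s :: real
    assume p: "p \<in> P n a" and q: "q \<in> P n a" and s: "0 < s" "s < 1"
      and eq: "?v a = (1 - s) *\<^sub>R p + s *\<^sub>R q"
    have "r + ?v a = (1 - s) *\<^sub>R (r + p) + s *\<^sub>R (r + q)" unfolding eq by (simp add: algebra_simps)
    then have "?v b = (1 - s) *\<^sub>R ((1 / real N) *\<^sub>R (r + p)) + s *\<^sub>R ((1 / real N) *\<^sub>R (r + q))"
      unfolding vb by (simp add: scaleR_add_right mult.commute)
    from extreme_point_of_eq[OF ext rP[OF p] rP[OF q] s this]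
    show "p = ?v a" "q = ?v a" unfolding vb using N by auto
  qed
qed

text \<open>By \<open>P_unit_decompose\<close> the polytope of the raised weight lies in the
  Minkowski sum of \<open>P n a\<close> and the hull of the antichain points, so a vertex of that
  sum lying in the polytope is a vertex of it.\<close>

lemma extreme_point_P_extend:
  assumes v: "v extreme_point_of P n a" and i: "i \<in> {1..n - 1}"
  shows "\<exists>A. A \<subseteq> Q n i \<and> antichain A \<and> (v + chi A) extreme_point_of P n (\<lambda>j. a j + of_bool (j = i))"
proof -
  have "\<exists>l\<in>antichain_points n i.
      (v + l) extreme_point_of {k + u |k u. k \<in> P n a \<and> u \<in> convex hull (antichain_points n i)}"
    by (rule extreme_point_plus_hull[OF convex_P v finite_antichain_points antichain_points_nonempty])
  then obtain A where A: "A \<subseteq> Q n i" "antichain A"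
    and ext: "(v + chi A) extreme_point_of {k + u |k u. k \<in> P n a \<and> u \<in> convex hull (antichain_points n i)}"
    unfolding antichain_points_def by blast
  have "v + chi A \<in> P n (\<lambda>j. a j + of_bool (j = i))"
    using v by (intro P_add chi_in_P i A) (auto simp: extreme_point_of_def)
  moreover have "P n (\<lambda>j. a j + of_bool (j = i)) \<subseteq>
      {k + u |k u. k \<in> P n a \<and> u \<in> convex hull (antichain_points n i)}"
    using P_unit_decompose[OF i, of _ a] by blast
  ultimately have "(v + chi A) extreme_point_of P n (\<lambda>j. a j + of_bool (j = i))"
    using ext unfolding extreme_point_of_def by blast
  then show ?thesis using A by blast
qed

lemma extreme_point_P_extend_all:
  assumes v: "v extreme_point_of P n a"
  shows "\<exists>A. (\<forall>i\<in>{1..n - 1}. A i \<subseteq> Q n i \<and> antichain (A i)) \<and>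
     (v + (\<Sum>i = 1..n - 1. chi (A i))) extreme_point_of P n (\<lambda>j. a j + 1)"
proof -
  have "\<exists>A. (\<forall>i\<in>I. A i \<subseteq> Q n i \<and> antichain (A i)) \<and>
     (v + (\<Sum>i\<in>I. chi (A i))) extreme_point_of P n (\<lambda>j. a j + of_bool (j \<in> I))"
    if "finite I" "I \<subseteq> {1..n - 1}" for I
    using that
  proof (induction I)
    case empty
    then show ?case using v by simp
  next
    case (insert i I)
    then obtain A where A: "\<forall>i\<in>I. A i \<subseteq> Q n i \<and> antichain (A i)"
      and ext: "(v + (\<Sum>i\<in>I. chi (A i))) extreme_point_of P n (\<lambda>j. a j + of_bool (j \<in> I))" by auto
    from extreme_point_P_extend[OF ext, of i] insert.prems obtain B where B: "B \<subseteq> Q n i" "antichain B"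
      and ext': "(v + (\<Sum>i\<in>I. chi (A i)) + chi B) extreme_point_of
        P n (\<lambda>j. a j + of_bool (j \<in> I) + of_bool (j = i))" by auto
    have "(\<Sum>k\<in>insert i I. chi ((A(i := B)) k)) = chi B + (\<Sum>k\<in>I. chi (A k))"
      using insert.hyps by (auto intro: sum.cong)
    moreover have "P n (\<lambda>j. a j + of_bool (j \<in> I) + of_bool (j = i)) = P n (\<lambda>j. a j + of_bool (j \<in> insert i I))"
      using insert.hyps by (intro P_cong) auto
    ultimately have "(v + (\<Sum>k\<in>insert i I. chi ((A(i := B)) k))) extreme_point_of
        P n (\<lambda>j. a j + of_bool (j \<in> insert i I))"
      using ext' by (simp add: ac_simps)
    moreover have "\<forall>k\<in>insert i I. (A(i := B)) k \<subseteq> Q n k \<and> antichain ((A(i := B)) k)" using A B by auto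
    ultimately show ?case by blast
  qed
  from this[of "{1..n - 1}"] obtain A where A: "\<forall>i\<in>{1..n - 1}. A i \<subseteq> Q n i \<and> antichain (A i)"
    and "(v + (\<Sum>i = 1..n - 1. chi (A i))) extreme_point_of P n (\<lambda>j. a j + of_bool (j \<in> {1..n - 1}))" by auto
  moreover have "P n (\<lambda>j. a j + of_bool (j \<in> {1..n - 1})) = P n (\<lambda>j. a j + 1)"
    by (intro P_cong) auto
  ultimately show ?thesis by metis
qed

text \<open>Induction on the total weight: split \<open>v\<close> as \<open>v' + u\<close> at some
  \<open>i\<close> with \<open>a i > 0\<close>. The vertex then contains both \<open>u\<close> and
  \<open>chi (A i)\<close> as summands from the same unit polytope, and an exchange argument forces
  them to agree.\<close>

lemma extreme_point_summand_eq:
  assumes A: "\<And>i. i \<in> {1..n - 1} \<Longrightarrow> A i \<subseteq> Q n i \<and> antichain (A i)"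
    and "v \<in> P n a"
    and "(v + (\<Sum>i = 1..n - 1. chi (A i))) extreme_point_of P n (\<lambda>j. a j + 1)"
  shows "v = (\<Sum>i = 1..n - 1. real (a i) *\<^sub>R chi (A i))"
  using assms(2,3)
proof (induction "\<Sum>i = 1..n - 1. a i" arbitrary: a v)
  case 0
  then have a: "a i = 0" if "i \<in> {1..n - 1}" for i using that by auto
  then have "P n a = P n (\<lambda>j. 0)" by (intro P_cong)
  then show ?case using 0 P_eq_0 a by simp
next
  case (Suc N)
  let ?l = "\<Sum>i = 1..n - 1. chi (A i)"
  from Suc.hyps(2) have "(\<Sum>i = 1..n - 1. a i) \<noteq> 0" by linarith
  then obtain i where i: "i \<in> {1..n - 1}" "a i \<noteq> 0" by (meson sum.neutral)
  define a' where "a' = a(i := a i - 1)"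
  have a: "a = (\<lambda>j. a' j + of_bool (j = i))" using i by (auto simp: a'_def)
  have l_split: "?l = chi (A i) + (\<Sum>j\<in>{1..n - 1} - {i}. chi (A j))" using i by (simp add: sum.remove)
  have chiP: "chi (A i) \<in> P n (\<lambda>j. of_bool (j = i))" using i A by (intro chi_in_P) auto
  have lP: "?l \<in> P n (\<lambda>j. 1)" using sum_chi_in_P[OF A, of "\<lambda>_. 1"] by simp
  from Suc.prems(1) have "v \<in> P n (\<lambda>j. a' j + of_bool (j = i))" using a by simp
  from P_unit_decompose[OF i(1) this] obtain v' u
    where v': "v' \<in> P n a'" and u: "u \<in> convex hull (antichain_points n i)" and v: "v = v' + u" by blast
  have "convex hull (antichain_points n i) \<subseteq> P n (\<lambda>j. of_bool (j = i))"
    unfolding antichain_points_def using chi_in_P[OF i(1)] by (intro hull_minimal convex_P) auto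
  then have uP: "u \<in> P n (\<lambda>j. of_bool (j = i))" using u by blast
  \<comment> \<open>Trading \<open>chi (A i)\<close> in \<open>?l\<close> for a second
    \<open>u\<close>, or \<open>u\<close> in \<open>v\<close> for a second \<open>chi (A i)\<close>,
    moves \<open>v + ?l\<close> by plus or minus \<open>u - chi (A i)\<close>; both results stay in
    the polytope.\<close>
  have "v + (?l - chi (A i) + u) \<in> P n (\<lambda>j. a j + 1)"
  proof (rule P_add[OF Suc.prems(1)])
    have "(\<Sum>j = 1..n - 1. real (of_bool (j \<noteq> i)) *\<^sub>R chi (A j)) \<in> P n (\<lambda>j. of_bool (j \<noteq> i))"
      by (rule sum_chi_in_P[OF A])
    moreover have "(\<Sum>j = 1..n - 1. real (of_bool (j \<noteq> i)) *\<^sub>R chi (A j)) = ?l - chi (A i)"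
      using i by (simp add: sum.remove[of _ i] l_split)
    ultimately have "?l - chi (A i) + u \<in> P n (\<lambda>j. of_bool (j \<noteq> i) + of_bool (j = i))" using uP P_add by metis
    then show "?l - chi (A i) + u \<in> P n (\<lambda>j. 1)" by (simp add: of_bool_def if_distrib cong: if_cong)
  qed
  moreover have "(v' + chi (A i)) + ?l \<in> P n (\<lambda>j. a j + 1)"
    by (subst a) (intro P_add v' chiP lP)
  ultimately have "u - chi (A i) = 0"
    by (intro extreme_point_of_symmetric[OF Suc.prems(2)]) (simp_all add: v algebra_simps)
  then have u_eq: "u = chi (A i)" by simp
  \<comment> \<open>Adding \<open>chi (A i)\<close> maps the polytope of \<open>a' + 1\<close> into
    that of \<open>a + 1\<close> and \<open>v' + ?l\<close> to the vertex \<open>v + ?l\<close>, so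
    a nontrivial segment through \<open>v' + ?l\<close> would give one through
    \<open>v + ?l\<close>.\<close>
  have "(v' + ?l) extreme_point_of P n (\<lambda>j. a' j + 1)"
    unfolding extreme_point_of_iff
  proof (intro conjI ballI allI impI)
    show "v' + ?l \<in> P n (\<lambda>j. a' j + 1)" by (intro P_add v' lP)
    have shift: "p + chi (A i) \<in> P n (\<lambda>j. a j + 1)" if "p \<in> P n (\<lambda>j. a' j + 1)" for p
      using P_add[OF that chiP] by (subst a) (simp add: ac_simps)
    fix p q and s :: real
    assume p: "p \<in> P n (\<lambda>j. a' j + 1)" and q: "q \<in> P n (\<lambda>j. a' j + 1)" and s: "0 < s" "s < 1"
      and eq: "v' + ?l = (1 - s) *\<^sub>R p + s *\<^sub>R q"
    have "v + ?l = v' + ?l + chi (A i)" by (simp add: v u_eq)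
    also have "\<dots> = (1 - s) *\<^sub>R (p + chi (A i)) + s *\<^sub>R (q + chi (A i))"
      unfolding eq by (simp add: algebra_simps)
    finally have "v + ?l = \<dots>" .
    from extreme_point_of_eq[OF Suc.prems(2) shift[OF p] shift[OF q] s this]
    show "p = v' + ?l" "q = v' + ?l" by (simp_all add: v u_eq algebra_simps)
  qed
  moreover have "N = (\<Sum>i = 1..n - 1. a' i)"
    using Suc.hyps(2) i(1) unfolding a by (simp add: sum.distrib)
  ultimately have "v' = (\<Sum>j = 1..n - 1. real (a' j) *\<^sub>R chi (A j))" by (intro Suc.hyps(1) v')
  moreover have "(\<Sum>j = 1..n - 1. real (of_bool (j = i)) *\<^sub>R chi (A j)) = chi (A i)"
    using i by (simp add: sum.remove[of _ i])
  ultimately show ?case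
    unfolding v u_eq by (subst a) (simp add: scaleR_add_left sum.distrib)
qed

theorem theorem2p7:
  fixes n :: nat and a :: "nat \<Rightarrow> nat" and v :: point
  assumes "n \<ge> 2"
    and "\<exists>i \<in> {1..n - 1}. a i = 0"
    and "v \<in> U n"
  shows "v extreme_point_of P n a \<longleftrightarrow>
         (\<exists>A. nice n A \<and> v = (\<Sum>i = 1..n - 1. real (a i) *\<^sub>R chi (A i)))"
proof
  assume v: "v extreme_point_of P n a"
  then have vP: "v \<in> P n a" by (simp add: extreme_point_of_def)
  from extreme_point_P_extend_all[OF v] obtain A
    where A: "\<And>i. i \<in> {1..n - 1} \<Longrightarrow> A i \<subseteq> Q n i \<and> antichain (A i)"
      and ext: "(v + (\<Sum>i = 1..n - 1. chi (A i))) extreme_point_of P n (\<lambda>j. a j + 1)" by blast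
  have v_eq: "v = (\<Sum>i = 1..n - 1. real (a i) *\<^sub>R chi (A i))"
    by (rule extreme_point_summand_eq[OF A vP ext])
  then have "v + (\<Sum>i = 1..n - 1. chi (A i)) = (\<Sum>i = 1..n - 1. real (a i + 1) *\<^sub>R chi (A i))"
    by (simp add: scaleR_add_left sum.distrib)
  with ext have "(\<Sum>i = 1..n - 1. real (a i + 1) *\<^sub>R chi (A i)) extreme_point_of P n (\<lambda>j. a j + 1)" by simp
  \<comment> \<open>The weight \<open>a + 1\<close> is positive everywhere, so its vertex property
    carries over to every positive weight.\<close>
  then have "nice n A"
    unfolding nice_def using A extreme_point_sum_chi_support[of n A "\<lambda>j. a j + 1"] by simp
  with v_eq show "\<exists>A. nice n A \<and> v = (\<Sum>i = 1..n - 1. real (a i) *\<^sub>R chi (A i))" by blast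
next
  assume "\<exists>A. nice n A \<and> v = (\<Sum>i = 1..n - 1. real (a i) *\<^sub>R chi (A i))"
  then obtain A where nice: "nice n A" and v: "v = (\<Sum>i = 1..n - 1. real (a i) *\<^sub>R chi (A i))" by blast
  have A: "\<And>i. i \<in> {1..n - 1} \<Longrightarrow> A i \<subseteq> Q n i \<and> antichain (A i)"
    using nice unfolding nice_def by blast
  \<comment> \<open>Niceness is tested at the all-ones weight, whose full support covers that of
    \<open>a\<close>.\<close>
  from nice have "(\<forall>i\<in>{1..n - 1}. (0::nat) < 1) \<longrightarrow>
      (\<Sum>i = 1..n - 1. real 1 *\<^sub>R chi (A i)) extreme_point_of P n (\<lambda>_. 1)"
    unfolding nice_def by (elim conjE allE[of _ "\<lambda>_. 1"])
  then have ext: "(\<Sum>i = 1..n - 1. real 1 *\<^sub>R chi (A i)) extreme_point_of P n (\<lambda>_. 1)" by simp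
  show "v extreme_point_of P n a"
    unfolding v by (rule extreme_point_sum_chi_support[OF A ext]) simp_all
qed

end
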